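(* Let $n \ge 1$ and let $R \in \mathbb{R}^{n\times n}$ be a rotation matrix. Then the minimal $L^1$ norm of the rotated lattice $R\mathbb{Z}^n = \{R\omega : \omega \in \mathbb{Z}^n\}$ satisfies $$\min_{\substack{\mathbf{t} \in R\mathbb{Z}^n \\ \mathbf{t} \neq \mathbf{0}}} \|\mathbf{t}\|_1 \le \sqrt{n},$$ with equality if and only if $R$ is a Hadamard rotation.
   Context: Here "rotation matrix" means a real orthogonal matrix ($R^T R = I$; determinant $-1$ is allowed). $\|\mathbf{t}\|_1 = \sum_{i=1}^n |t_i|$. A (real) Hadamard matrix is a square matrix $W \in \mathbb{R}^{n\times n}$ all of whose entries are $\pm 1$ and whose column vectors are mutually orthogonal (equivalently $W^T W = nI$). A Hadamard rotation is a matrix of the form $W/\sqrt{n}$ with $W$ an $n \times n$ Hadamard matrix. *)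

theory Defs
  imports "HOL-Analysis.Analysis"
begin

definition l1_norm :: "real ^ 'n \<Rightarrow> real" where
  "l1_norm t = (\<Sum>i\<in>UNIV. \<bar>t $ i\<bar>)"

definition integer_lattice :: "(real ^ 'n) set" where
  "integer_lattice = {w. \<forall>i. w $ i \<in> \<int>}"

definition rotated_lattice :: "real ^ 'n ^ 'n \<Rightarrow> (real ^ 'n) set" where
  "rotated_lattice R = (\<lambda>w. R *v w) ` integer_lattice"

definition nonzero_l1_norms :: "real ^ 'n ^ 'n \<Rightarrow> real set" where
  "nonzero_l1_norms R = l1_norm ` {t \<in> rotated_lattice R. t \<noteq> 0}"

text \<open>
  An infimum is not a minimum unless it is attained; statements about this quantity as a minimum
  should assert its membership in \<open>nonzero_l1_norms R\<close> as well.
\<close>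
definition min_l1_norm :: "real ^ 'n ^ 'n \<Rightarrow> real" where
  "min_l1_norm R = Inf (nonzero_l1_norms R)"

definition hadamard_matrix :: "real ^ 'n ^ 'n \<Rightarrow> bool" where
  "hadamard_matrix W \<longleftrightarrow>
     (\<forall>i j. W $ i $ j = 1 \<or> W $ i $ j = - 1) \<and>
     (\<forall>i j. i \<noteq> j \<longrightarrow> orthogonal (column i W) (column j W))"

definition hadamard_rotation :: "real ^ 'n ^ 'n \<Rightarrow> bool" where
  "hadamard_rotation R \<longleftrightarrow>
     (\<exists>W. hadamard_matrix W \<and> R = (1 / sqrt (real CARD('n))) *\<^sub>R W)"

end

(* Pairing t = R w with the j-th column of R recovers w_j. This makes sublevel sets of the
   L1 norm on the lattice finite, and it gives |t|_1 >= sqrt n whenever all entries of R have absolute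
   value 1 / sqrt n. Conversely the columns of R are themselves lattice vectors, of Euclidean norm 1, so
   Cauchy-Schwarz and its equality case give the bound and the characterization of equality. *)
theory Submission
  imports Defs
begin

text \<open>Expanding the squares leaves 1 from the unit norm, 1 from n copies of 1/n, and the cross
  term. This is Cauchy-Schwarz with its defect made explicit: nonnegativity of the left side gives
  the bound by sqrt n, and its vanishing forces all entries to have absolute value 1 / sqrt
  n.\<close>

lemma l1_norm_column_identity:
  fixes x :: "real ^ 'n"
  assumes "norm x = 1"
  shows "(\<Sum>i\<in>UNIV. (\<bar>x $ i\<bar> - 1 / sqrt (real CARD('n)))\<^sup>2) = 2 - 2 * l1_norm x / sqrt (real CARD('n))"
proof -
  have "(\<Sum>i\<in>UNIV. (x $ i)\<^sup>2) = x \<bullet> x"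
    by (simp add: inner_vec_def power2_eq_square)
  also have "\<dots> = 1"
    using assms by (simp add: dot_square_norm)
  finally have sq: "(\<Sum>i\<in>UNIV. (x $ i)\<^sup>2) = 1" .
  have "(\<Sum>i\<in>UNIV. (\<bar>x $ i\<bar> - 1 / sqrt (real CARD('n)))\<^sup>2)
      = (\<Sum>i\<in>UNIV. (x $ i)\<^sup>2 + 1 / real CARD('n) - 2 / sqrt (real CARD('n)) * \<bar>x $ i\<bar>)"
    by (intro sum.cong refl) (simp add: power2_diff power_divide)
  also have "\<dots> = 2 - 2 * l1_norm x / sqrt (real CARD('n))"
    by (simp add: sum.distrib sum_subtractf sq l1_norm_def sum_distrib_left sum_divide_distrib)
  finally show ?thesis .
qed

lemma l1_norm_le_sqrt_card:
  fixes x :: "real ^ 'n"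
  assumes "norm x = 1"
  shows "l1_norm x \<le> sqrt (real CARD('n))"
proof -
  have "0 \<le> 2 - 2 * l1_norm x / sqrt (real CARD('n))"
    unfolding l1_norm_column_identity[OF assms, symmetric] by (intro sum_nonneg) simp
  then show ?thesis
    by (simp add: divide_simps)
qed

lemma abs_entries_of_l1_norm_eq:
  fixes x :: "real ^ 'n"
  assumes "norm x = 1" and "l1_norm x = sqrt (real CARD('n))"
  shows "\<bar>x $ i\<bar> = 1 / sqrt (real CARD('n))"
proof -
  have "(\<Sum>i\<in>UNIV. (\<bar>x $ i\<bar> - 1 / sqrt (real CARD('n)))\<^sup>2) = 0"
    using l1_norm_column_identity[OF assms(1)] assms(2) by simp
  then have "\<forall>i\<in>UNIV. (\<bar>x $ i\<bar> - 1 / sqrt (real CARD('n)))\<^sup>2 = 0"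
    by (subst (asm) sum_nonneg_eq_0_iff) auto
  then show ?thesis
    by simp
qed

text \<open>Since the transpose inverts \<open>R\<close>, the coordinate \<open>w $ j\<close> is the
  inner product of column \<open>j\<close> with \<open>R *v w\<close>, and the triangle inequality
  applies. The bound serves twice: with \<open>b\<close> = 1 for finiteness, and with
  \<open>b\<close> = 1 / sqrt n for the lower bound in the Hadamard case.\<close>

lemma abs_coordinate_le_l1_norm:
  fixes R :: "real ^ 'n ^ 'n"
  assumes "orthogonal_matrix R" and "\<And>i. \<bar>R $ i $ j\<bar> \<le> b"
  shows "\<bar>w $ j\<bar> \<le> b * l1_norm (R *v w)"
proof -
  have "w = transpose R *v (R *v w)"
    using assms(1) by (simp add: matrix_vector_mul_assoc orthogonal_matrix)
  then have "w $ j = (transpose R *v (R *v w)) $ j"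
    by (rule arg_cong)
  also have "\<dots> = (\<Sum>i\<in>UNIV. R $ i $ j * (R *v w) $ i)"
    unfolding matrix_vector_mult_def[of "transpose R"] by (simp add: transpose_def)
  finally have "\<bar>w $ j\<bar> \<le> (\<Sum>i\<in>UNIV. \<bar>R $ i $ j * (R *v w) $ i\<bar>)"
    by (simp only: sum_abs)
  also have "\<dots> \<le> (\<Sum>i\<in>UNIV. b * \<bar>(R *v w) $ i\<bar>)"
    by (intro sum_mono) (simp add: abs_mult mult_right_mono assms(2))
  also have "\<dots> = b * l1_norm (R *v w)"
    by (simp add: l1_norm_def sum_distrib_left)
  finally show ?thesis .
qed

lemma finite_bounded_integer_lattice:
  "finite {w \<in> (integer_lattice :: (real ^ 'n) set). \<forall>i. \<bar>w $ i\<bar> \<le> C}"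
proof (rule finite_subset)
  let ?S = "{k \<in> \<int>. \<bar>k :: real\<bar> \<le> C}"
  show "{w \<in> (integer_lattice :: (real ^ 'n) set). \<forall>i. \<bar>w $ i\<bar> \<le> C}
      \<subseteq> vec_lambda ` (UNIV \<rightarrow>\<^sub>E ?S)"
  proof
    fix w :: "real ^ 'n"
    assume "w \<in> {w \<in> integer_lattice. \<forall>i. \<bar>w $ i\<bar> \<le> C}"
    \<comment> \<open>Over \<open>UNIV\<close> the extensionality condition of the function space is
      vacuous.\<close>
    then have "vec_nth w \<in> UNIV \<rightarrow>\<^sub>E ?S"
      by (auto simp: integer_lattice_def)
    then show "w \<in> vec_lambda ` (UNIV \<rightarrow>\<^sub>E ?S)"
      by (metis image_eqI vec_nth_inverse)
  qed
  show "finite (vec_lambda ` (UNIV \<rightarrow>\<^sub>E ?S) :: (real ^ 'n) set)"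
    by (intro finite_imageI finite_PiE finite_abs_int_segment) simp
qed

text \<open>A lattice vector of L1 norm at most \<open>C\<close> comes from an integer vector with
  all coordinates bounded by \<open>C\<close>, and there are finitely many of those. This is what
  makes the infimum a minimum.\<close>

lemma finite_nonzero_l1_norms_le:
  fixes R :: "real ^ 'n ^ 'n"
  assumes "orthogonal_matrix R"
  shows "finite (nonzero_l1_norms R \<inter> {..C})"
proof (rule finite_subset)
  let ?B = "{w \<in> (integer_lattice :: (real ^ 'n) set). \<forall>i. \<bar>w $ i\<bar> \<le> C}"
  show "nonzero_l1_norms R \<inter> {..C} \<subseteq> (\<lambda>w. l1_norm (R *v w)) ` ?B"
  proof
    fix s
    assume s: "s \<in> nonzero_l1_norms R \<inter> {..C}"
    then obtain w where w: "w \<in> integer_lattice" "s = l1_norm (R *v w)"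
      by (auto simp: nonzero_l1_norms_def rotated_lattice_def)
    \<comment> \<open>The columns are unit vectors, so no entry exceeds 1 in absolute value.\<close>
    have "\<bar>R $ i $ j\<bar> \<le> 1" for i j
      using assms component_le_norm_cart[of "column j R" i]
      by (simp add: orthogonal_matrix_orthonormal_columns column_def)
    then have "\<bar>w $ j\<bar> \<le> 1 * l1_norm (R *v w)" for j
      by (rule abs_coordinate_le_l1_norm[OF assms])
    then have "\<bar>w $ j\<bar> \<le> C" for j
      using s w(2) by (metis IntD2 atMost_iff mult_1 order_trans)
    with w show "s \<in> (\<lambda>w. l1_norm (R *v w)) ` ?B"
      by blast
  qed
  show "finite ((\<lambda>w. l1_norm (R *v w)) ` ?B)"
    by (intro finite_imageI finite_bounded_integer_lattice)
qed

text \<open>Elements of \<open>S\<close> above \<open>s\<close> cannot undercut the minimum of the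
  finite segment up to \<open>s\<close>, so that minimum is least in all of
  \<open>S\<close>.\<close>

lemma Inf_in_set_of_finite_initial_segment:
  fixes S :: "'a :: conditionally_complete_linorder set"
  assumes "s \<in> S" and "finite (S \<inter> {..s})"
  shows "Inf S \<in> S"
    and "\<And>x. x \<in> S \<Longrightarrow> Inf S \<le> x"
proof -
  let ?m = "Min (S \<inter> {..s})"
  have m: "?m \<in> S \<inter> {..s}"
    using assms by (intro Min_in) auto
  have le: "?m \<le> x" if "x \<in> S" for x
  proof (cases "x \<le> s")
    case True
    with that assms show ?thesis by (intro Min_le) auto
  next
    case False
    with m show ?thesis by auto
  qed
  have "Inf S = ?m"
    using m le by (intro cInf_eq_minimum) auto
  with m le show "Inf S \<in> S" and "\<And>x. x \<in> S \<Longrightarrow> Inf S \<le> x"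
    by auto
qed

text \<open>Column \<open>j\<close> is the image of the integer vector \<open>axis j 1\<close>, and
  its unit norm keeps it away from zero.\<close>

lemma l1_norm_column_mem:
  fixes R :: "real ^ 'n ^ 'n"
  assumes "norm (column j R) = 1"
  shows "l1_norm (column j R) \<in> nonzero_l1_norms R"
proof -
  have "axis j 1 \<in> (integer_lattice :: (real ^ 'n) set)"
    by (simp add: integer_lattice_def axis_def)
  then have "column j R \<in> rotated_lattice R"
    unfolding rotated_lattice_def by (rule rev_image_eqI) (simp add: matrix_vector_mult_basis)
  moreover have "column j R \<noteq> 0"
    using assms by auto
  ultimately show ?thesis
    by (auto simp: nonzero_l1_norms_def)
qed

text \<open>Rescaling by sqrt n preserves orthogonality of the columns, so for an orthogonal
  \<open>R\<close> only the absolute values of the entries matter.\<close>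

lemma hadamard_rotation_iff_abs_entries:
  fixes R :: "real ^ 'n ^ 'n"
  assumes "orthogonal_matrix R"
  shows "hadamard_rotation R \<longleftrightarrow> (\<forall>i j. \<bar>R $ i $ j\<bar> = 1 / sqrt (real CARD('n)))"
proof
  assume "hadamard_rotation R"
  then obtain W where "\<And>i j. W $ i $ j = 1 \<or> W $ i $ j = - 1"
    and R: "R = (1 / sqrt (real CARD('n))) *\<^sub>R W"
    by (auto simp: hadamard_rotation_def hadamard_matrix_def)
  then have "\<bar>W $ i $ j\<bar> = 1" for i j
    by (metis abs_1 abs_minus_cancel)
  then show "\<forall>i j. \<bar>R $ i $ j\<bar> = 1 / sqrt (real CARD('n))"
    by (simp add: R abs_mult)
next
  assume entries: "\<forall>i j. \<bar>R $ i $ j\<bar> = 1 / sqrt (real CARD('n))"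
  define W where "W = sqrt (real CARD('n)) *\<^sub>R R"
  have "\<bar>W $ i $ j\<bar> = 1" for i j
    using entries by (simp add: W_def abs_mult)
  then have "W $ i $ j = 1 \<or> W $ i $ j = - 1" for i j
    by (metis abs_eq_iff abs_1)
  moreover have "column j W = sqrt (real CARD('n)) *\<^sub>R column j R" for j
    by (simp add: W_def column_def vec_eq_iff)
  then have "orthogonal (column i W) (column j W)" if "i \<noteq> j" for i j
    using assms that by (simp add: orthogonal_matrix_orthonormal_columns orthogonal_clauses)
  ultimately have "hadamard_matrix W"
    by (auto simp: hadamard_matrix_def)
  moreover have "R = (1 / sqrt (real CARD('n))) *\<^sub>R W"
    by (simp add: W_def)
  ultimately show "hadamard_rotation R"
    by (auto simp: hadamard_rotation_def)
qed

text \<open>A nonzero integer vector has a coordinate of absolute value at least 1, while that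
  coordinate is at most the L1 norm of the image divided by sqrt n.\<close>

lemma sqrt_card_le_l1_norm:
  fixes R :: "real ^ 'n ^ 'n"
  assumes "orthogonal_matrix R" and "hadamard_rotation R" and "s \<in> nonzero_l1_norms R"
  shows "sqrt (real CARD('n)) \<le> s"
proof -
  obtain w where w: "w \<in> integer_lattice" "R *v w \<noteq> 0" "s = l1_norm (R *v w)"
    using assms(3) by (auto simp: nonzero_l1_norms_def rotated_lattice_def)
  then obtain j where "w $ j \<noteq> 0"
    by (metis matrix_vector_mult_0_right vec_eq_iff zero_index)
  with w(1) have "1 \<le> \<bar>w $ j\<bar>"
    by (auto simp: integer_lattice_def intro: Ints_nonzero_abs_ge1)
  also have "\<dots> \<le> 1 / sqrt (real CARD('n)) * s"
    unfolding w(3) using assms(2)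
    by (intro abs_coordinate_le_l1_norm assms(1))
       (simp add: hadamard_rotation_iff_abs_entries[OF assms(1)])
  finally show ?thesis
    by (simp add: divide_simps)
qed

theorem propositionV1:
  fixes R :: "real ^ 'n ^ 'n"
  assumes "orthogonal_matrix R"
  shows "min_l1_norm R \<in> nonzero_l1_norms R
    \<and> min_l1_norm R \<le> sqrt (real CARD('n))
    \<and> (min_l1_norm R = sqrt (real CARD('n)) \<longleftrightarrow> hadamard_rotation R)"
proof -
  have unit: "norm (column j R) = 1" for j
    using assms by (simp add: orthogonal_matrix_orthonormal_columns)
  \<comment> \<open>The norm of a column serves as the element at which the initial segment is cut
    off; \<open>Inf(1)\<close> is attainment, \<open>Inf(2)\<close> minimality.\<close>
  note Inf = Inf_in_set_of_finite_initial_segment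
    [OF l1_norm_column_mem[OF unit] finite_nonzero_l1_norms_le[OF assms], folded min_l1_norm_def]
  have col: "min_l1_norm R \<le> l1_norm (column j R)" for j
    by (intro Inf(2) l1_norm_column_mem unit)
  have le: "min_l1_norm R \<le> sqrt (real CARD('n))"
    using col l1_norm_le_sqrt_card[OF unit] by (rule order_trans)
  have "hadamard_rotation R" if "min_l1_norm R = sqrt (real CARD('n))"
  proof -
    \<comment> \<open>Every column norm is squeezed between the minimum, here sqrt n, and the upper
      bound sqrt n for unit vectors.\<close>
    have "l1_norm (column j R) = sqrt (real CARD('n))" for j
      using col[of j] l1_norm_le_sqrt_card[OF unit, of j] that by simp
    from abs_entries_of_l1_norm_eq[OF unit this]
    show ?thesis
      by (simp add: hadamard_rotation_iff_abs_entries[OF assms] column_def)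
  qed
  moreover have "min_l1_norm R = sqrt (real CARD('n))" if "hadamard_rotation R"
    using le sqrt_card_le_l1_norm[OF assms that Inf(1)] by (rule antisym)
  ultimately show ?thesis
    using Inf(1) le by blast
qed

end
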